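(* Let $2 \leq t+1 < r_1 \leq \dots \leq r_k$ (with $k\geq 2$), and for each $i \in [k]$ let $\mathcal{F}_i = \mathcal{C}_{n_i,r_i}$ with $n_i \geq (r_i-t-1)\,c(r_{k-1},r_k,t) + t + 1$. Then $(\mathcal{F}_1, \dots, \mathcal{F}_k)$ has the extrastrong cross-$t$-star property.
   Context: A composition of $n$ of length $r$ is a tuple $(a_1,\dots,a_r)$ of positive integers with $a_1+\dots+a_r=n$; $C_{n,r}$ is the set of these. A composition $\mathbf{a}=(a_1,\dots,a_r)$ is represented by the set $S_{\mathbf{a}}=\{(1,a_1),\dots,(r,a_r)\}$, and $\mathcal{C}_{n,r}=\{S_{\mathbf{a}}:\mathbf{a}\in C_{n,r}\}$. $c(r,s,t)=\max\{r\binom{s}{t},s\binom{r}{t}\}+1$ if $t\leq\min\{r,s\}$, and $1$ otherwise. $\mathcal{F}(T)=\{F\in\mathcal{F}:T\subseteq F\}$. Families $\mathcal{A}_1,\dots,\mathcal{A}_k$ are cross-$t$-intersecting if for all distinct $i,j$ each set of $\mathcal{A}_i$ shares at least $t$ elements with each set of $\mathcal{A}_j$; the tuple is below $(\mathcal{F}_1,\dots,\mathcal{F}_k)$ if $\mathcal{A}_i\subseteq\mathcal{F}_i$. Extrastrong cross-$t$-star property: there is a $t$-set $T$ such that for every cross-$t$-intersecting tuple below $(\mathcal{F}_1,\dots,\mathcal{F}_k)$, $\prod|\mathcal{A}_i|\leq\prod|\mathcal{F}_i(T)|$, with equality only if there is a $t$-set $T'$ with $\mathcal{A}_i=\mathcal{F}_i(T')$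 for all $i$. *)

theory Defs
  imports Complex_Main
begin

text \<open>
  Tuples with entries indexed by \<open>[k] = {1, ..., k}\<close> are functions on \<open>nat\<close>,
  of which only the values on \<open>{1..k}\<close> matter.
\<close>

definition compositions :: "nat \<Rightarrow> nat \<Rightarrow> nat list set" where
  "compositions n r = {a. length a = r \<and> (\<forall>x\<in>set a. 0 < x) \<and> sum_list a = n}"

text \<open>List positions are counted from 0, so the entry \<open>a\<^sub>i\<close> of the composition is \<open>a ! (i - 1)\<close>.\<close>

definition composition_set :: "nat list \<Rightarrow> (nat \<times> nat) set" where
  "composition_set a = {(i, a ! (i - 1)) | i. i \<in> {1..length a}}"

definition composition_family :: "nat \<Rightarrow> nat \<Rightarrow> (nat \<times> nat) set set" where
  "composition_family n r = composition_set ` compositions n r"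

definition c_bound :: "nat \<Rightarrow> nat \<Rightarrow> nat \<Rightarrow> nat" where
  "c_bound r s t = (if t \<le> min r s then max (r * (s choose t)) (s * (r choose t)) + 1 else 1)"

definition subfamily_containing :: "'a set set \<Rightarrow> 'a set \<Rightarrow> 'a set set" where
  "subfamily_containing F T = {A \<in> F. T \<subseteq> A}"

text \<open>As usual in extremal set theory, families are understood to be finite families of finite
  sets; the uses of \<open>card\<close> below have their intended meaning in that case.\<close>

definition cross_intersecting :: "nat \<Rightarrow> nat \<Rightarrow> (nat \<Rightarrow> 'a set set) \<Rightarrow> bool" where
  "cross_intersecting t k \<A> \<longleftrightarrow>
    (\<forall>i\<in>{1..k}. \<forall>j\<in>{1..k}. i \<noteq> j \<longrightarrow> (\<forall>A\<in>\<A> i. \<forall>B\<in>\<A> j. t \<le> card (A \<inter> B)))"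

definition below :: "nat \<Rightarrow> (nat \<Rightarrow> 'a set set) \<Rightarrow> (nat \<Rightarrow> 'a set set) \<Rightarrow> bool" where
  "below k \<A> \<F> \<longleftrightarrow> (\<forall>i\<in>{1..k}. \<A> i \<subseteq> \<F> i)"

definition extrastrong_cross_star :: "nat \<Rightarrow> nat \<Rightarrow> (nat \<Rightarrow> 'a set set) \<Rightarrow> bool" where
  "extrastrong_cross_star t k \<F> \<longleftrightarrow>
    (\<exists>T. finite T \<and> card T = t \<and>
      (\<forall>\<A>. cross_intersecting t k \<A> \<and> below k \<A> \<F> \<longrightarrow>
        (\<Prod>i\<in>{1..k}. card (\<A> i)) \<le> (\<Prod>i\<in>{1..k}. card (subfamily_containing (\<F> i) T)) \<and>
        ((\<Prod>i\<in>{1..k}. card (\<A> i)) = (\<Prod>i\<in>{1..k}. card (subfamily_containing (\<F> i) T)) \<longrightarrow>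
          (\<exists>T'. finite T' \<and> card T' = t \<and>
            (\<forall>i\<in>{1..k}. \<A> i = subfamily_containing (\<F> i) T')))))"

end

theory Submission
  imports Defs
begin

text \<open>
  Let \<open>\<A>\<close>, \<open>\<B>\<close> be nonempty cross-\<open>t\<close>-intersecting families of \<open>r\<close>-sets and \<open>s\<close>-sets. A member of
  \<open>\<A>\<close> has \<open>r choose t\<close> many \<open>t\<close>-subsets, and every member of \<open>\<B>\<close> contains one of them. If
  moreover some \<open>B \<in> \<B>\<close> does not contain the \<open>t\<close>-set \<open>T\<close>, then every member of \<open>\<A>\<close> containing \<open>T\<close>
  contains one of the at most \<open>s\<close> sets \<open>T \<union> {x}\<close> with \<open>x \<in> B - T\<close>. Hence, unless \<open>\<A>\<close> and \<open>\<B>\<close> are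
  contained in stars with a common centre, one of the two factors loses the quotient between the
  largest \<open>t\<close>-star and the largest \<open>(t+1)\<close>-star. For compositions of \<open>n\<close> of length \<open>r\<close> this quotient
  is \<open>(n - t - 1) / (r - t - 1)\<close>, which outweighs the constants for large \<open>n\<close>. The case of \<open>k\<close>
  families follows by multiplying the bounds over all pairs of families.
\<close>

section \<open>Two cross-intersecting families\<close>

lemma subfamily_containing_mono:
  "\<A> \<subseteq> F \<Longrightarrow> T \<subseteq> T' \<Longrightarrow> subfamily_containing \<A> T' \<subseteq> subfamily_containing F T"
  by (auto simp: subfamily_containing_def)

lemma finite_subfamily_containing: "finite F \<Longrightarrow> finite (subfamily_containing F T)"
  by (simp add: subfamily_containing_def)

text \<open>Each \<open>A\<close> contains a \<open>t\<close>-subset of \<open>A \<inter> B\<close>,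
  hence a \<open>t\<close>-subset of \<open>B\<close>; a union bound over the
  \<open>card B choose t\<close> candidates gives the estimate.\<close>

lemma card_le_choose_mult:
  assumes "finite \<A>" "finite B"
    and inter: "\<And>A. A \<in> \<A> \<Longrightarrow> t \<le> card (A \<inter> B)"
    and bound: "\<And>T. T \<subseteq> B \<Longrightarrow> card T = t \<Longrightarrow> card (subfamily_containing \<A> T) \<le> d"
  shows "card \<A> \<le> (card B choose t) * d"
proof -
  let ?S = "{T. T \<subseteq> B \<and> card T = t}"
  have fin: "finite ?S" using \<open>finite B\<close> by simp
  have "\<A> \<subseteq> (\<Union>T\<in>?S. subfamily_containing \<A> T)"
  proof
    fix A assume A: "A \<in> \<A>"
    obtain T where "T \<subseteq> A \<inter> B" "card T = t"
      using obtain_subset_with_card_n[OF inter[OF A]] by blast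
    then show "A \<in> (\<Union>T\<in>?S. subfamily_containing \<A> T)"
      using A by (auto simp: subfamily_containing_def)
  qed
  then have "card \<A> \<le> card (\<Union>T\<in>?S. subfamily_containing \<A> T)"
    using fin \<open>finite \<A>\<close> by (intro card_mono finite_UN_I finite_subfamily_containing)
  also have "\<dots> \<le> (\<Sum>T\<in>?S. card (subfamily_containing \<A> T))"
    by (rule card_UN_le[OF fin])
  also have "\<dots> \<le> card ?S * d"
    using sum_bounded_above[of ?S "\<lambda>T. card (subfamily_containing \<A> T)" d] bound by simp
  also have "card ?S = card B choose t"
    using n_subsets[OF \<open>finite B\<close>] .
  finally show ?thesis .
qed

text \<open>If \<open>T \<subseteq> A\<close> but \<open>A\<close> had no element of
  \<open>B - T\<close>, then \<open>A \<inter> B\<close> would be a proper subset of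
  \<open>T\<close> and have fewer than \<open>t\<close> elements. So the star of \<open>T\<close> is
  covered by the stars of the \<open>(t+1)\<close>-sets \<open>insert x T\<close> with
  \<open>x \<in> B - T\<close>.\<close>

lemma card_subfamily_containing_le_mult:
  assumes "finite \<A>" "finite B" "finite T" "card T = t" "\<not> T \<subseteq> B"
    and inter: "\<And>A. A \<in> \<A> \<Longrightarrow> t \<le> card (A \<inter> B)"
    and bound: "\<And>T'. finite T' \<Longrightarrow> card T' = Suc t \<Longrightarrow> card (subfamily_containing \<A> T') \<le> d"
  shows "card (subfamily_containing \<A> T) \<le> card B * d"
proof -
  have fin: "finite (B - T)" using \<open>finite B\<close> by simp
  have "subfamily_containing \<A> T \<subseteq> (\<Union>x\<in>B - T. subfamily_containing \<A> (insert x T))"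
  proof
    fix A assume "A \<in> subfamily_containing \<A> T"
    then have A: "A \<in> \<A>" "T \<subseteq> A" by (auto simp: subfamily_containing_def)
    have "\<not> A \<inter> B \<subseteq> T"
    proof
      assume "A \<inter> B \<subseteq> T"
      with \<open>\<not> T \<subseteq> B\<close> have "A \<inter> B \<subset> T" by blast
      then have "card (A \<inter> B) < t"
        using psubset_card_mono \<open>finite T\<close> \<open>card T = t\<close> by blast
      with inter[OF A(1)] show False by simp
    qed
    then show "A \<in> (\<Union>x\<in>B - T. subfamily_containing \<A> (insert x T))"
      using A by (auto simp: subfamily_containing_def)
  qed
  then have "card (subfamily_containing \<A> T)
      \<le> card (\<Union>x\<in>B - T. subfamily_containing \<A> (insert x T))"
    using fin \<open>finite \<A>\<close> by (intro card_mono finite_UN_I finite_subfamily_containing)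
  also have "\<dots> \<le> (\<Sum>x\<in>B - T. card (subfamily_containing \<A> (insert x T)))"
    by (rule card_UN_le[OF fin])
  also have "\<dots> \<le> card (B - T) * d"
    using sum_bounded_above[of "B - T" "\<lambda>x. card (subfamily_containing \<A> (insert x T))" d]
      bound \<open>finite T\<close> \<open>card T = t\<close> by simp
  also have "\<dots> \<le> card B * d"
    using \<open>finite B\<close> by (simp add: card_mono)
  finally show ?thesis .
qed

text \<open>Two branchings: a member of \<open>\<B>\<close> contains one of the
  \<open>r choose t\<close> many \<open>t\<close>-subsets \<open>T\<close> of \<open>A0\<close>.
  Since \<open>T\<close> is not a common centre of \<open>\<A>\<close>, some \<open>A\<close> fails
  to contain it, and this \<open>A\<close> offers at most \<open>r\<close> elements by which
  \<open>T\<close> must be extended.\<close>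

lemma card_le_of_cross_not_star:
  assumes "finite \<B>" "A0 \<in> \<A>"
    and sizes: "\<And>A. A \<in> \<A> \<Longrightarrow> finite A \<and> card A = r"
    and cross: "\<And>A B. A \<in> \<A> \<Longrightarrow> B \<in> \<B> \<Longrightarrow> t \<le> card (A \<inter> B)"
    and bound: "\<And>T. finite T \<Longrightarrow> card T = Suc t \<Longrightarrow> card (subfamily_containing \<B> T) \<le> g'"
    and not_star: "\<And>T. finite T \<Longrightarrow> card T = t \<Longrightarrow> \<exists>A\<in>\<A>. \<not> T \<subseteq> A"
  shows "card \<B> \<le> (r choose t) * (r * g')"
proof -
  have A0: "finite A0" "card A0 = r" using sizes \<open>A0 \<in> \<A>\<close> by auto
  have "card \<B> \<le> (card A0 choose t) * (r * g')"
  proof (rule card_le_choose_mult)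
    fix T assume T: "T \<subseteq> A0" "card T = t"
    then have "finite T" using A0(1) finite_subset by blast
    with not_star T obtain A where A: "A \<in> \<A>" "\<not> T \<subseteq> A" by blast
    have "card (subfamily_containing \<B> T) \<le> card A * g'"
      using sizes[OF A(1)] A(2) cross[OF A(1)] \<open>finite T\<close> T(2) \<open>finite \<B>\<close> bound
      by (intro card_subfamily_containing_le_mult[where t = t])
         (auto simp: Int_commute)
    then show "card (subfamily_containing \<B> T) \<le> r * g'"
      using sizes[OF A(1)] by simp
  qed (use \<open>finite \<B>\<close> A0 cross[OF \<open>A0 \<in> \<A>\<close>] in \<open>auto simp: Int_commute\<close>)
  then show ?thesis using A0 by simp
qed

text \<open>The cases are whether \<open>\<A>\<close>, or \<open>\<B>\<close>, lies in a
  \<open>t\<close>-star. A centre of one family either serves the other as well or is missed by one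
  of its members, which makes the first family small; without any centre both families are
  small.\<close>

lemma cross_product_less_or_common_star:
  assumes fin: "finite \<A>" "finite \<B>"
    and sizesA: "\<And>A. A \<in> \<A> \<Longrightarrow> finite A \<and> card A = r"
    and sizesB: "\<And>B. B \<in> \<B> \<Longrightarrow> finite B \<and> card B = s"
    and cross: "\<And>A B. A \<in> \<A> \<Longrightarrow> B \<in> \<B> \<Longrightarrow> t \<le> card (A \<inter> B)"
    and f: "\<And>T. finite T \<Longrightarrow> card T = t \<Longrightarrow> card (subfamily_containing \<A> T) \<le> f"
    and f': "\<And>T. finite T \<Longrightarrow> card T = Suc t \<Longrightarrow> card (subfamily_containing \<A> T) \<le> f'"
    and g: "\<And>T. finite T \<Longrightarrow> card T = t \<Longrightarrow> card (subfamily_containing \<B> T) \<le> g"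
    and g': "\<And>T. finite T \<Longrightarrow> card T = Suc t \<Longrightarrow> card (subfamily_containing \<B> T) \<le> g'"
    and ff': "s * (r choose t) * f' < f"
    and gg': "r * (s choose t) * g' < g"
  shows "card \<A> * card \<B> < f * g \<or>
    (\<exists>T. finite T \<and> card T = t \<and> (\<forall>A\<in>\<A>. T \<subseteq> A) \<and> (\<forall>B\<in>\<B>. T \<subseteq> B))"
proof (cases "\<A> = {} \<or> \<B> = {}")
  case True
  \<comment> \<open>The product is 0, while \<open>ff'\<close> and \<open>gg'\<close> force
    \<open>f\<close> and \<open>g\<close> to be positive.\<close>
  then show ?thesis using ff' gg' by auto
next
  case False
  then obtain A0 B0 where A0: "A0 \<in> \<A>" and B0: "B0 \<in> \<B>" by auto
  have cross': "t \<le> card (B \<inter> A)" if "A \<in> \<A>" "B \<in> \<B>" for A B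
    using cross[OF that] by (simp add: Int_commute)
  have B_le: "card \<B> \<le> (r choose t) * g"
  proof -
    have "card \<B> \<le> (card A0 choose t) * g"
      using fin sizesA[OF A0] cross'[OF A0] g finite_subset by (intro card_le_choose_mult) auto
    then show ?thesis using sizesA[OF A0] by simp
  qed
  have A_le: "card \<A> \<le> (s choose t) * f"
  proof -
    have "card \<A> \<le> (card B0 choose t) * f"
      using fin sizesB[OF B0] cross[OF _ B0] f finite_subset by (intro card_le_choose_mult) auto
    then show ?thesis using sizesB[OF B0] by simp
  qed
  have A_star: "card \<A> \<le> s * f'"
    if T: "finite T" "card T = t" "\<forall>A\<in>\<A>. T \<subseteq> A" and B: "B \<in> \<B>" "\<not> T \<subseteq> B" for T B
  proof -
    have "card (subfamily_containing \<A> T) \<le> card B * f'"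
      using fin sizesB[OF B(1)] T B cross[OF _ B(1)] f'
      by (intro card_subfamily_containing_le_mult[where t = t]) auto
    moreover have "subfamily_containing \<A> T = \<A>"
      using T(3) by (auto simp: subfamily_containing_def)
    ultimately show ?thesis using sizesB[OF B(1)] by simp
  qed
  have B_star: "card \<B> \<le> r * g'"
    if T: "finite T" "card T = t" "\<forall>B\<in>\<B>. T \<subseteq> B" and A: "A \<in> \<A>" "\<not> T \<subseteq> A" for T A
  proof -
    have "card (subfamily_containing \<B> T) \<le> card A * g'"
      using fin sizesA[OF A(1)] T A cross'[OF A(1)] g'
      by (intro card_subfamily_containing_le_mult[where t = t]) auto
    moreover have "subfamily_containing \<B> T = \<B>"
      using T(3) by (auto simp: subfamily_containing_def)
    ultimately show ?thesis using sizesA[OF A(1)] by simp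
  qed
  consider
    (A) T where "finite T" "card T = t" "\<forall>A\<in>\<A>. T \<subseteq> A"
  | (B) T where "finite T" "card T = t" "\<forall>B\<in>\<B>. T \<subseteq> B"
  | (none) "\<And>T. finite T \<Longrightarrow> card T = t \<Longrightarrow> \<exists>A\<in>\<A>. \<not> T \<subseteq> A"
      "\<And>T. finite T \<Longrightarrow> card T = t \<Longrightarrow> \<exists>B\<in>\<B>. \<not> T \<subseteq> B"
    by blast
  then show ?thesis
  proof cases
    case A
    show ?thesis
    proof (cases "\<forall>B\<in>\<B>. T \<subseteq> B")
      case False
      then have "card \<A> \<le> s * f'" using A_star[OF A] by blast
      then have "card \<A> * card \<B> \<le> (s * f') * ((r choose t) * g)"
        using B_le by (intro mult_le_mono)
      \<comment> \<open>The factor \<open>s\<close> comes from extending \<open>T\<close> inside a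
        member of \<open>\<B>\<close>, the binomial coefficient from the crude bound on
        \<open>\<B>\<close>; together they form the constant of \<open>ff'\<close>.\<close>
      also have "\<dots> = (s * (r choose t) * f') * g" by simp
      also have "\<dots> < f * g" using ff' gg' by simp
      finally show ?thesis ..
    qed (use A in blast)
  next
    case B
    show ?thesis
    proof (cases "\<forall>A\<in>\<A>. T \<subseteq> A")
      case False
      then have "card \<B> \<le> r * g'" using B_star[OF B] by blast
      then have "card \<A> * card \<B> \<le> ((s choose t) * f) * (r * g')"
        using A_le by (intro mult_le_mono)
      also have "\<dots> = f * (r * (s choose t) * g')" by simp
      also have "\<dots> < f * g" using ff' gg' by simp
      finally show ?thesis ..
    qed (use B in blast)
  next
    case none
    have "card \<B> \<le> (r choose t) * (r * g')"
      using fin(2) A0 sizesA cross g' none(1) by (rule card_le_of_cross_not_star)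
    moreover have "card \<A> \<le> (s choose t) * (s * f')"
      using fin(1) B0 sizesB cross' f' none(2) by (rule card_le_of_cross_not_star)
    ultimately have "card \<A> * card \<B> \<le> ((s choose t) * (s * f')) * ((r choose t) * (r * g'))"
      by (intro mult_le_mono)
    \<comment> \<open>The two binomial coefficients change places, so that \<open>ff'\<close> and
      \<open>gg'\<close> apply to one factor each.\<close>
    also have "\<dots> = (s * (r choose t) * f') * (r * (s choose t) * g')" by simp
    also have "\<dots> < f * g"
      using ff' gg' by (intro mult_strict_mono) auto
    finally show ?thesis ..
  qed
qed

section \<open>From two families to \<open>k\<close> families\<close>

text \<open>Each index is the first entry of \<open>card I - 1\<close> ordered pairs and the second
  entry of equally many; exchanging the two products turns the second count into the first.\<close>

lemma prod_pairs_eq_power: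
  fixes a :: "nat \<Rightarrow> nat"
  assumes "finite I"
  shows "(\<Prod>i\<in>I. \<Prod>j\<in>I - {i}. a i * a j) = (\<Prod>i\<in>I. a i) ^ (2 * (card I - 1))"
proof -
  have *: "(\<Prod>i\<in>I. \<Prod>j\<in>I - {i}. a i) = (\<Prod>i\<in>I. a i) ^ (card I - 1)"
    by (simp add: prod_power_distrib)
  have "(\<Prod>i\<in>I. \<Prod>j\<in>I - {i}. a j) = (\<Prod>i\<in>I. \<Prod>j\<in>{j. j \<in> I \<and> i \<noteq> j}. a j)"
    by (intro prod.cong refl) auto
  also have "\<dots> = (\<Prod>j\<in>I. \<Prod>i\<in>{i. i \<in> I \<and> i \<noteq> j}. a j)"
    using assms by (intro prod.swap_restrict)
  also have "\<dots> = (\<Prod>j\<in>I. \<Prod>i\<in>I - {j}. a j)"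
    by (intro prod.cong refl) auto
  finally have "(\<Prod>i\<in>I. \<Prod>j\<in>I - {i}. a j) = (\<Prod>i\<in>I. a i) ^ (card I - 1)"
    using * by simp
  with * show ?thesis
    by (simp add: prod.distrib mult_2 power_add)
qed

lemma prod_strict_mono_at:
  fixes a b :: "'i \<Rightarrow> nat"
  assumes "finite I" "\<And>i. i \<in> I \<Longrightarrow> a i \<le> b i" "\<And>i. i \<in> I \<Longrightarrow> 0 < b i" "i \<in> I" "a i < b i"
  shows "prod a I < prod b I"
proof -
  have "prod a (I - {i}) \<le> prod b (I - {i})"
    using assms by (intro prod_mono) auto
  moreover have "0 < prod b (I - {i})"
    using assms by (intro prod_pos) auto
  ultimately have "a i * prod a (I - {i}) < b i * prod b (I - {i})"
    using assms by (metis le_less_trans mult_le_mono2 mult_less_mono1)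
  then show ?thesis
    using assms by (simp add: prod.remove)
qed

text \<open>Multiplying the inequalities over all ordered pairs compares equal powers of the two
  full products, and the strict pair \<open>p\<close>, \<open>q\<close> makes the comparison
  strict.\<close>

lemma prod_less_of_pairs:
  fixes a f :: "nat \<Rightarrow> nat"
  assumes "finite I" and pos: "\<And>i. i \<in> I \<Longrightarrow> 0 < f i"
    and le: "\<And>i j. i \<in> I \<Longrightarrow> j \<in> I \<Longrightarrow> i \<noteq> j \<Longrightarrow> a i * a j \<le> f i * f j"
    and less: "p \<in> I" "q \<in> I" "p \<noteq> q" "a p * a q < f p * f q"
  shows "prod a I < prod f I"
proof -
  have "(\<Prod>i\<in>I. \<Prod>j\<in>I - {i}. a i * a j) < (\<Prod>i\<in>I. \<Prod>j\<in>I - {i}. f i * f j)"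
  proof (rule prod_strict_mono_at[OF \<open>finite I\<close> _ _ \<open>p \<in> I\<close>])
    show "(\<Prod>j\<in>I - {p}. a p * a j) < (\<Prod>j\<in>I - {p}. f p * f j)"
      using assms by (intro prod_strict_mono_at[where i = q]) auto
  qed (use assms in \<open>auto intro!: prod_mono prod_pos\<close>)
  then have "prod a I ^ (2 * (card I - 1)) < prod f I ^ (2 * (card I - 1))"
    using \<open>finite I\<close> by (simp only: prod_pairs_eq_power)
  then show ?thesis
    by (rule power_less_imp_less_base) simp
qed

text \<open>A star with two distinct centres of size \<open>t\<close> would lie in the star of a
  \<open>(t+1)\<close>-set, which is too small. This later glues the centres found for different
  pairs.\<close>

lemma card_subfamily_eq_imp_center_eq:
  assumes "finite F" "finite T" "finite T'" "card T = t" "card T' = t"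
    and bound: "\<And>S. finite S \<Longrightarrow> card S = Suc t \<Longrightarrow> card (subfamily_containing F S) \<le> f'"
    and big: "f' < card (subfamily_containing F T)"
    and eq: "subfamily_containing F T = subfamily_containing F T'"
  shows "T = T'"
proof (rule ccontr)
  assume "T \<noteq> T'"
  with assms have "\<not> T' \<subseteq> T" by (metis card_subset_eq)
  then obtain x where x: "x \<in> T'" "x \<notin> T" by auto
  have "subfamily_containing F T \<subseteq> subfamily_containing F (insert x T)"
    using eq x by (auto simp: subfamily_containing_def)
  then have "card (subfamily_containing F T) \<le> card (subfamily_containing F (insert x T))"
    using \<open>finite F\<close> by (intro card_mono finite_subfamily_containing)
  also have "\<dots> \<le> f'"
    using bound assms x by simp
  finally show False using big by simp
qed

text \<open>Separates the combinatorics from the counting: \<open>f i\<close> is the largest size of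
  a \<open>t\<close>-star in \<open>F i\<close>, attained at one \<open>T\<close> for all
  \<open>i\<close>, and \<open>f' i\<close> bounds the \<open>(t+1)\<close>-stars.
  \<open>ratio\<close> feeds the two-family result for every pair; \<open>less\<close> makes the
  centre of a largest star unique.\<close>

lemma extrastrong_cross_star_of_bounds:
  fixes F :: "nat \<Rightarrow> 'a set set" and r f f' :: "nat \<Rightarrow> nat"
  assumes "k \<ge> 2"
    and fin: "\<And>i. i \<in> {1..k} \<Longrightarrow> finite (F i)"
    and sizes: "\<And>i A. i \<in> {1..k} \<Longrightarrow> A \<in> F i \<Longrightarrow> finite A \<and> card A = r i"
    and T: "finite T" "card T = t" "\<And>i. i \<in> {1..k} \<Longrightarrow> card (subfamily_containing (F i) T) = f i"
    and f: "\<And>i S. i \<in> {1..k} \<Longrightarrow> finite S \<Longrightarrow> card S = t \<Longrightarrow>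
        card (subfamily_containing (F i) S) \<le> f i"
    and f': "\<And>i S. i \<in> {1..k} \<Longrightarrow> finite S \<Longrightarrow> card S = Suc t \<Longrightarrow>
        card (subfamily_containing (F i) S) \<le> f' i"
    and less: "\<And>i. i \<in> {1..k} \<Longrightarrow> f' i < f i"
    and ratio: "\<And>i j. i \<in> {1..k} \<Longrightarrow> j \<in> {1..k} \<Longrightarrow> i \<noteq> j \<Longrightarrow>
        r j * (r i choose t) * f' i < f i"
  shows "extrastrong_cross_star t k F"
  unfolding extrastrong_cross_star_def
proof (rule exI[of _ T], intro conjI T(1,2) allI impI)
  fix \<A> assume "cross_intersecting t k \<A> \<and> below k \<A> F"
  then have cross: "\<And>i j A B. i \<in> {1..k} \<Longrightarrow> j \<in> {1..k} \<Longrightarrow> i \<noteq> j \<Longrightarrow> A \<in> \<A> i \<Longrightarrow> B \<in> \<A> j \<Longrightarrow>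
        t \<le> card (A \<inter> B)"
    and sub: "\<And>i. i \<in> {1..k} \<Longrightarrow> \<A> i \<subseteq> F i"
    by (auto simp: cross_intersecting_def below_def)
  have finA: "finite (\<A> i)" if "i \<in> {1..k}" for i
    using fin sub that finite_subset by blast
  have pos: "0 < f i" if "i \<in> {1..k}" for i
    using less[OF that] by simp
  have A_bound: "card (subfamily_containing (\<A> i) S) \<le> card (subfamily_containing (F i) S)"
    if "i \<in> {1..k}" for i S
    using sub fin that
    by (intro card_mono finite_subfamily_containing subfamily_containing_mono) auto
  have pair: "card (\<A> i) * card (\<A> j) < f i * f j \<or>
      (\<exists>S. finite S \<and> card S = t \<and> (\<forall>A\<in>\<A> i. S \<subseteq> A) \<and> (\<forall>B\<in>\<A> j. S \<subseteq> B))"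
    if ij: "i \<in> {1..k}" "j \<in> {1..k}" "i \<noteq> j" for i j
  proof (rule cross_product_less_or_common_star)
    show "r j * (r i choose t) * f' i < f i" "r i * (r j choose t) * f' j < f j"
      using ij ratio by auto
    show "finite A \<and> card A = r i" if "A \<in> \<A> i" for A
      using that ij sizes sub by blast
    show "finite A \<and> card A = r j" if "A \<in> \<A> j" for A
      using that ij sizes sub by blast
    show "finite (\<A> i)" "finite (\<A> j)"
      using ij finA by auto
    show "t \<le> card (A \<inter> B)" if "A \<in> \<A> i" "B \<in> \<A> j" for A B
      using ij that by (rule cross)
    fix S :: "'a set" assume S: "finite S"
    show "card S = t \<Longrightarrow> card (subfamily_containing (\<A> i) S) \<le> f i"
      by (rule order.trans[OF A_bound[OF ij(1)] f[OF ij(1) S]])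
    show "card S = t \<Longrightarrow> card (subfamily_containing (\<A> j) S) \<le> f j"
      by (rule order.trans[OF A_bound[OF ij(2)] f[OF ij(2) S]])
    show "card S = Suc t \<Longrightarrow> card (subfamily_containing (\<A> i) S) \<le> f' i"
      by (rule order.trans[OF A_bound[OF ij(1)] f'[OF ij(1) S]])
    show "card S = Suc t \<Longrightarrow> card (subfamily_containing (\<A> j) S) \<le> f' j"
      by (rule order.trans[OF A_bound[OF ij(2)] f'[OF ij(2) S]])
  qed
  have star_le: "card (\<A> i) \<le> f i \<and> (card (\<A> i) = f i \<longrightarrow> \<A> i = subfamily_containing (F i) S)"
    if i: "i \<in> {1..k}" and S: "finite S" "card S = t" "\<forall>A\<in>\<A> i. S \<subseteq> A" for i S
  proof -
    have s: "\<A> i \<subseteq> subfamily_containing (F i) S"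
      using sub[OF i] S(3) by (auto simp: subfamily_containing_def)
    have fs: "finite (subfamily_containing (F i) S)"
      using fin[OF i] by (rule finite_subfamily_containing)
    show ?thesis
      using card_mono[OF fs s] card_subset_eq[OF fs s] f[OF i S(1,2)] by auto
  qed
  have pair_le: "card (\<A> i) * card (\<A> j) \<le> f i * f j"
    if "i \<in> {1..k}" "j \<in> {1..k}" "i \<noteq> j" for i j
    using pair[OF that]
  proof (elim disjE exE conjE)
    fix S assume "finite S" "card S = t" "\<forall>A\<in>\<A> i. S \<subseteq> A" "\<forall>B\<in>\<A> j. S \<subseteq> B"
    then show ?thesis
      using star_le[OF that(1)] star_le[OF that(2)] by (intro mult_le_mono) blast+
  qed simp
  let ?P = "\<Prod>i\<in>{1..k}. card (\<A> i)" and ?Q = "\<Prod>i\<in>{1..k}. f i"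
  have Q: "(\<Prod>i\<in>{1..k}. card (subfamily_containing (F i) T)) = ?Q"
    by (intro prod.cong refl T(3))
  have main: "?P < ?Q \<or> (\<exists>T'. finite T' \<and> card T' = t \<and>
      (\<forall>i\<in>{1..k}. card (\<A> i) = f i \<and> \<A> i = subfamily_containing (F i) T'))"
  \<comment> \<open>One strict pair makes the whole product strict. Otherwise every pair consists of
    full stars with a common centre, and it remains to see that this centre is the same for all
    pairs.\<close>
  proof (cases "\<exists>i\<in>{1..k}. \<exists>j\<in>{1..k}. i \<noteq> j \<and> card (\<A> i) * card (\<A> j) < f i * f j")
    case True
    then show ?thesis
      using prod_less_of_pairs[of "{1..k}" f "\<lambda>i. card (\<A> i)"] pos pair_le by blast
  next
    case False
    have star: "\<exists>S. finite S \<and> card S = t \<and> card (\<A> i) = f i \<and> card (\<A> j) = f j \<and>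
        \<A> i = subfamily_containing (F i) S \<and> \<A> j = subfamily_containing (F j) S"
      if ij: "i \<in> {1..k}" "j \<in> {1..k}" "i \<noteq> j" for i j
    proof -
      obtain S where S: "finite S" "card S = t" "\<forall>A\<in>\<A> i. S \<subseteq> A" "\<forall>B\<in>\<A> j. S \<subseteq> B"
        using pair[OF ij] False ij by blast
      have le: "card (\<A> i) \<le> f i" "card (\<A> j) \<le> f j"
        using star_le S ij by blast+
      have ge: "f i * f j \<le> card (\<A> i) * card (\<A> j)"
        using False ij by (meson not_le)
      have "card (\<A> i) = f i"
      proof (rule ccontr)
        assume "card (\<A> i) \<noteq> f i"
        then have "card (\<A> i) * card (\<A> j) < f i * f j"
          using le pos[OF ij(2)] by (meson le_less_trans le_neq_implies_less mult_le_mono2 mult_less_mono1)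
        with ge show False by simp
      qed
      moreover have "card (\<A> j) = f j"
      proof (rule ccontr)
        assume "card (\<A> j) \<noteq> f j"
        then have "card (\<A> i) * card (\<A> j) < f i * f j"
          using le pos[OF ij(1)] by (meson le_less_trans le_neq_implies_less mult_le_mono1 mult_less_mono2)
        with ge show False by simp
      qed
      ultimately show ?thesis
        using star_le S ij by blast
    qed
    \<comment> \<open>Index 1 is the anchor: its pair with 2 supplies the centre \<open>S\<close>,
      and every other family is compared with \<open>\<A> 1\<close>.\<close>
    have 12: "1 \<in> {1..k}" "2 \<in> {1..k}" "(1::nat) \<noteq> 2" using \<open>k \<ge> 2\<close> by auto
    obtain S where S: "finite S" "card S = t" "card (\<A> 1) = f 1"
        "\<A> 1 = subfamily_containing (F 1) S"
      using star[OF 12] by blast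
    have "card (\<A> i) = f i \<and> \<A> i = subfamily_containing (F i) S" if i: "i \<in> {1..k}" for i
    proof (cases "i = 1")
      case False
      then obtain S' where S': "finite S'" "card S' = t" "card (\<A> i) = f i"
          "\<A> 1 = subfamily_containing (F 1) S'" "\<A> i = subfamily_containing (F i) S'"
        using star[OF 12(1) i] by auto
      \<comment> \<open>Both sets are centres of the same largest star
        \<open>\<A> 1\<close>.\<close>
      have "S = S'"
        using fin[OF 12(1)] S(1) S'(1) S(2) S'(2) f'[OF 12(1)]
      proof (rule card_subfamily_eq_imp_center_eq)
        show "f' 1 < card (subfamily_containing (F 1) S)"
          using S less[OF 12(1)] by simp
      qed (use S S' in auto)
      with S' show ?thesis by simp
    qed (use S in auto)
    with S show ?thesis by blast
  qed
  show "?P \<le> (\<Prod>i\<in>{1..k}. card (subfamily_containing (F i) T))"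
    unfolding Q using main
  proof (elim disjE exE conjE)
    fix T' assume "\<forall>i\<in>{1..k}. card (\<A> i) = f i \<and> \<A> i = subfamily_containing (F i) T'"
    then have "?P = ?Q" by (intro prod.cong) blast+
    then show "?P \<le> ?Q" by simp
  qed simp
  show "\<exists>T'. finite T' \<and> card T' = t \<and> (\<forall>i\<in>{1..k}. \<A> i = subfamily_containing (F i) T')"
    if "?P = (\<Prod>i\<in>{1..k}. card (subfamily_containing (F i) T))"
    using main that unfolding Q by auto
qed

section \<open>Stars of composition families\<close>

lemma mem_composition_set: "(p, x) \<in> composition_set a \<longleftrightarrow> 1 \<le> p \<and> p \<le> length a \<and> x = a ! (p - 1)"
  by (auto simp: composition_set_def)

text \<open>The zero-based form, as an image under a map that is injective through its first
  coordinate; cardinalities and sets of positions are computed from it.\<close>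

lemma composition_set_eq: "composition_set a = (\<lambda>i. (Suc i, a ! i)) ` {..<length a}"
proof (intro set_eqI iffI)
  fix y assume "y \<in> composition_set a"
  then obtain i where "i \<in> {1..length a}" "y = (i, a ! (i - 1))"
    by (auto simp: composition_set_def)
  then show "y \<in> (\<lambda>i. (Suc i, a ! i)) ` {..<length a}"
    by (intro image_eqI[of _ _ "i - 1"]) auto
qed (auto simp: composition_set_def)

lemma composition_set_finite_card: "finite (composition_set a) \<and> card (composition_set a) = length a"
  by (auto simp: composition_set_eq card_image inj_on_def)

lemma composition_set_inj:
  assumes "composition_set a = composition_set b"
  shows "a = b"
proof (rule nth_equalityI)
  show len: "length a = length b"
    using composition_set_finite_card assms by metis
  fix i assume "i < length a"
  then have "(Suc i, a ! i) \<in> composition_set b"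
    using assms mem_composition_set[of "Suc i" "a ! i" a] by simp
  then show "a ! i = b ! i" by (simp add: mem_composition_set)
qed

lemma finite_compositions: "finite (compositions n r)"
proof (rule finite_subset)
  show "compositions n r \<subseteq> {xs. set xs \<subseteq> {..n} \<and> length xs = r}"
    by (auto simp: compositions_def dest: member_le_sum_list)
qed (simp add: finite_lists_length_eq)

text \<open>Stars and bars, with the symmetry of binomial coefficients used to make the lower index
  depend on the length only, not on the sum.\<close>

lemma card_length_sum_list_choose:
  assumes "0 < m"
  shows "card {l :: nat list. length l = m \<and> sum_list l = N} = (N + m - 1) choose (m - 1)"
  using card_length_sum_list[of m N] binomial_symmetric[of N "N + m - 1"] assms by simp

text \<open>A composition containing \<open>T\<close> is determined by its entries at the positions not occurring in
  \<open>T\<close>. Subtracting 1 from each of them leaves a list of naturals whose sum is the same number \<open>N\<close> for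
  all such compositions, and \<open>N \<le> n - r\<close>.\<close>

lemma card_star_le:
  assumes T: "finite T" "card T = j" "j < r"
  shows "card (subfamily_containing (composition_family n r) T) \<le> (n - j - 1) choose (r - j - 1)"
proof (cases "\<exists>a0\<in>compositions n r. T \<subseteq> composition_set a0")
  case False
  then have "subfamily_containing (composition_family n r) T = {}"
    by (auto simp: subfamily_containing_def composition_family_def)
  then show ?thesis by simp
next
  case True
  then obtain a0 where a0: "a0 \<in> compositions n r" "T \<subseteq> composition_set a0" by blast
  define X where "X = {a \<in> compositions n r. T \<subseteq> composition_set a}"
  \<comment> \<open>\<open>I\<close> holds the zero-based positions fixed by \<open>T\<close>,
    \<open>ks\<close> lists the free ones, and \<open>h\<close> records the excess over 1 at the
    free positions.\<close>
  define I where "I = (\<lambda>y. fst y - 1) ` T"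
  define ks where "ks = filter (\<lambda>i. i \<notin> I) [0..<r]"
  define h where "h a = map (\<lambda>i. a ! i - 1) ks" for a :: "nat list"
  define N where "N = sum_list (h a0)"
  have I: "I \<subseteq> {..<r}"
    using a0 by (force simp: I_def composition_set_eq compositions_def)
  \<comment> \<open>\<open>T\<close> lies in the set of the single composition \<open>a0\<close>, so
    no position occurs in it twice.\<close>
  have inj: "inj_on (\<lambda>y. fst y - 1) T"
    by (rule inj_on_subset[OF _ a0(2)]) (auto simp: composition_set_eq inj_on_def)
  have cardI: "card I = j"
    using card_image[OF inj] T(2) by (simp add: I_def)
  have set_ks: "set ks = {..<r} - I" and dist: "distinct ks"
    by (auto simp: ks_def)
  have len_ks: "length ks = r - j"
    using distinct_card[OF dist] set_ks I cardI by (simp add: card_Diff_subset finite_subset)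
  have fixed: "a ! i = a0 ! i" if a: "a \<in> X" and i: "i \<in> I" for a i
  proof -
    obtain p x where px: "(p, x) \<in> T" "i = p - 1" using i by (auto simp: I_def)
    then have "(p, x) \<in> composition_set a" "(p, x) \<in> composition_set a0"
      using a a0 by (auto simp: X_def)
    then show ?thesis using px by (simp add: mem_composition_set)
  qed
  \<comment> \<open>The excesses of all \<open>r\<close> entries add up to \<open>n - r\<close>;
    those at \<open>I\<close> are the same throughout \<open>X\<close>, so the rest has a constant
    sum.\<close>
  have sum_h: "sum_list (h a) + (\<Sum>i\<in>I. a ! i - 1) + r = n" if "a \<in> compositions n r" for a
  proof -
    have a: "length a = r" "\<And>i. i < r \<Longrightarrow> 0 < a ! i" "sum_list a = n"
      using that by (auto simp: compositions_def)
    have "sum_list (h a) = (\<Sum>i\<in>{..<r} - I. a ! i - 1)"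
      unfolding h_def using sum.distinct_set_conv_list[OF dist, of "\<lambda>i. a ! i - 1"] set_ks by simp
    then have "sum_list (h a) + (\<Sum>i\<in>I. a ! i - 1) = (\<Sum>i<r. a ! i - 1)"
      using sum.subset_diff[OF I, of "\<lambda>i. a ! i - 1"] by simp
    also have "\<dots> + r = (\<Sum>i<r. (a ! i - 1) + 1)"
      by (simp add: sum.distrib del: add_Suc_right)
    also have "\<dots> = (\<Sum>i<r. a ! i)"
      using a(2) by (intro sum.cong) auto
    also have "\<dots> = n"
      using a by (simp add: sum_list_sum_nth atLeast0LessThan)
    finally show ?thesis .
  qed
  have "h a \<in> {l. length l = r - j \<and> sum_list l = N}" if a: "a \<in> X" for a
  proof -
    have "(\<Sum>i\<in>I. a ! i - 1) = (\<Sum>i\<in>I. a0 ! i - 1)"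
      using fixed[OF a] by simp
    then have "sum_list (h a) = N"
      using sum_h[OF a0(1)] sum_h[of a] a unfolding N_def by (simp add: X_def)
    then show ?thesis by (simp add: h_def len_ks)
  qed
  then have img: "h ` X \<subseteq> {l. length l = r - j \<and> sum_list l = N}" by auto
  have inj_h: "inj_on h X"
  proof (rule inj_onI, rule nth_equalityI)
    fix a b assume ab: "a \<in> X" "b \<in> X" "h a = h b"
    then have c: "length a = r" "length b = r" "\<And>i. i < r \<Longrightarrow> 0 < a ! i" "\<And>i. i < r \<Longrightarrow> 0 < b ! i"
      by (auto simp: X_def compositions_def)
    then show "length a = length b" by simp
    fix i assume "i < length a"
    then have i: "i < r" using c by simp
    show "a ! i = b ! i"
    proof (cases "i \<in> I")
      case True
      then show ?thesis using fixed ab by simp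
    next
      case False
      then have "a ! i - 1 = b ! i - 1"
        using ab(3) i set_ks by (auto simp: h_def)
      \<comment> \<open>Positive entries make the truncated subtraction of 1 reversible.\<close>
      then show ?thesis using c(3,4)[OF i] by simp
    qed
  qed
  have "subfamily_containing (composition_family n r) T = composition_set ` X"
    by (auto simp: subfamily_containing_def composition_family_def X_def)
  then have "card (subfamily_containing (composition_family n r) T) = card X"
    using composition_set_inj by (metis card_image inj_onI)
  also have "\<dots> \<le> card {l :: nat list. length l = r - j \<and> sum_list l = N}"
  proof (rule card_inj_on_le[OF inj_h img])
    show "finite {l :: nat list. length l = r - j \<and> sum_list l = N}"
      by (rule finite_subset[of _ "{xs. set xs \<subseteq> {..N} \<and> length xs = r - j}"])
         (auto dest: member_le_sum_list simp: finite_lists_length_eq)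
  qed
  also have "\<dots> = (N + (r - j) - 1) choose (r - j - 1)"
    using T(3) by (intro card_length_sum_list_choose) simp
  also have "\<dots> \<le> (n - j - 1) choose (r - j - 1)"
    using sum_h[OF a0(1)] T(3) by (intro binomial_right_mono) (simp add: N_def)
  finally show ?thesis .
qed

text \<open>Entries equal to 1 use up no excess, so the whole \<open>n - r\<close> is left for the
  other \<open>r - t\<close> positions and the upper bound for stars is attained. The centre depends
  on neither \<open>n\<close> nor \<open>r\<close>, so it can serve all families at once.\<close>

lemma card_initial_ones_star_ge:
  assumes "t < r" "r \<le> n"
  shows "(n - t - 1) choose (r - t - 1) \<le>
    card (subfamily_containing (composition_family n r) ((\<lambda>i. (i, 1)) ` {1..t}))"
proof -
  let ?L = "{l :: nat list. length l = r - t \<and> sum_list l = n - r}"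
  let ?h = "\<lambda>l. composition_set (replicate t 1 @ map Suc l)"
  have "?h ` ?L \<subseteq> subfamily_containing (composition_family n r) ((\<lambda>i. (i, 1)) ` {1..t})"
  proof clarify
    fix l :: "nat list" assume l: "length l = r - t" "sum_list l = n - r"
    have "sum_list (map Suc l) = sum_list l + length l" by (induction l) auto
    then have "replicate t 1 @ map Suc l \<in> compositions n r"
      using l assms by (auto simp: compositions_def sum_list_replicate)
    then show "?h l \<in> subfamily_containing (composition_family n r) ((\<lambda>i. (i, 1)) ` {1..t})"
      by (auto simp: subfamily_containing_def composition_family_def mem_composition_set nth_append)
  qed
  moreover have "inj_on ?h ?L"
    by (auto simp: inj_on_def dest!: composition_set_inj)
  ultimately have "card ?L \<le>
      card (subfamily_containing (composition_family n r) ((\<lambda>i. (i, 1)) ` {1..t}))"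
    by (intro card_inj_on_le finite_subfamily_containing)
       (auto simp: composition_family_def finite_compositions)
  then show ?thesis
    using card_length_sum_list_choose[of "r - t" "n - r"] assms by simp
qed

text \<open>By the absorption identity the quotient of the two binomial coefficients is
  \<open>(n - t - 1) / (r - t - 1)\<close>, which is at least \<open>Suc c\<close>; the surplus over
  \<open>c\<close> gives strictness.\<close>

lemma choose_ratio:
  assumes "t + 1 < r" "n \<ge> (r - t - 1) * Suc c + t + 1"
  shows "c * ((n - (t + 1) - 1) choose (r - (t + 1) - 1)) < (n - t - 1) choose (r - t - 1)"
proof -
  define p q where "p = r - (t + 1) - 1" and "q = n - (t + 1) - 1"
  have p: "r - t - 1 = Suc p" using assms(1) by (simp add: p_def)
  have "Suc p * Suc c + t + 1 \<le> n" using assms(2) p by simp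
  \<comment> \<open>Gives \<open>t + 1 < n\<close>, so that the truncated difference
    \<open>n - t - 1\<close> really is a successor.\<close>
  moreover have "Suc p \<le> Suc p * Suc c" by simp
  ultimately have q: "n - t - 1 = Suc q" and pq: "Suc p * Suc c \<le> Suc q"
    by (auto simp: q_def)
  have "p \<le> q" using pq by (simp add: add.commute)
  then have pos: "0 < q choose p" by simp
  have "Suc p * (Suc c * (q choose p)) \<le> Suc q * (q choose p)"
    using mult_le_mono1[OF pq, of "q choose p"] by (simp only: mult.assoc)
  also have "\<dots> = Suc p * (Suc q choose Suc p)"
    using Suc_times_binomial_eq[of q p] by (simp only: mult.commute)
  finally have "Suc c * (q choose p) \<le> Suc q choose Suc p"
    by (simp only: Suc_mult_le_cancel1)
  moreover have "c * (q choose p) < Suc c * (q choose p)" using pos by simp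
  ultimately have "c * (q choose p) < Suc q choose Suc p" by (rule order.strict_trans2[rotated])
  then show ?thesis by (simp only: p q flip: p_def q_def)
qed

section \<open>Assembly: one constant for all pairs of composition families\<close>

theorem theorem4p10:
  fixes t k :: nat and r n :: "nat \<Rightarrow> nat"
  assumes "k \<ge> 2"
    and "2 \<le> t + 1"
    and "t + 1 < r 1"
    and "mono_on {1..k} r"
    and "\<And>i. i \<in> {1..k} \<Longrightarrow> n i \<ge> (r i - t - 1) * c_bound (r (k - 1)) (r k) t + t + 1"
  shows "extrastrong_cross_star t k (\<lambda>i. composition_family (n i) (r i))"
proof -
  \<comment> \<open>The bound \<open>c_bound\<close> without its final 1, which becomes the
    successor in \<open>choose_ratio\<close>.\<close>
  define c where "c = max (r (k - 1) * (r k choose t)) (r k * (r (k - 1) choose t))"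
  have mono: "r i \<le> r j" if "i \<in> {1..k}" "j \<in> {1..k}" "i \<le> j" for i j
    using assms(4) that by (auto simp: mono_on_def)
  have r: "t + 1 < r i" if "i \<in> {1..k}" for i
    using mono[of 1 i] that assms(1,3) by simp
  have k: "k \<in> {1..k}" "k - 1 \<in> {1..k}" using assms(1) by auto
  have "t \<le> min (r (k - 1)) (r k)"
    using r[OF k(1)] r[OF k(2)] by simp
  then have n: "n i \<ge> (r i - t - 1) * Suc c + t + 1" if "i \<in> {1..k}" for i
    using assms(5)[OF that] by (simp add: c_bound_def c_def)
  have rn: "r i \<le> n i" if "i \<in> {1..k}" for i
    using n[OF that] r[OF that] by simp
  \<comment> \<open>Of two distinct indices the smaller is at most \<open>k - 1\<close> and the
    larger at most \<open>k\<close>; which one is smaller decides which entry of the maximum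
    dominates.\<close>
  have c_ge: "r j * (r i choose t) \<le> c" if ij: "i \<in> {1..k}" "j \<in> {1..k}" "i \<noteq> j" for i j
  proof (cases "i < j")
    case True
    then have "r i \<le> r (k - 1)" "r j \<le> r k"
      using ij mono[of i "k - 1"] mono[of j k] by auto
    then have "r j * (r i choose t) \<le> r k * (r (k - 1) choose t)"
      by (intro mult_le_mono binomial_right_mono)
    then show ?thesis by (simp add: c_def)
  next
    case False
    then have "r j \<le> r (k - 1)" "r i \<le> r k"
      using ij mono[of j "k - 1"] mono[of i k] by auto
    then have "r j * (r i choose t) \<le> r (k - 1) * (r k choose t)"
      by (intro mult_le_mono binomial_right_mono)
    then show ?thesis by (simp add: c_def)
  qed
  let ?T = "(\<lambda>i. (i, 1 :: nat)) ` {1..t}"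
  have T: "finite ?T" "card ?T = t" by (auto simp: card_image inj_on_def)
  have less: "c * ((n i - (t + 1) - 1) choose (r i - (t + 1) - 1))
      < (n i - t - 1) choose (r i - t - 1)" if "i \<in> {1..k}" for i
    using r[OF that] n[OF that] by (rule choose_ratio)
  \<comment> \<open>With \<open>c\<close> at least 1, the weighted comparison \<open>less\<close>
    also yields the plain one between the two star sizes.\<close>
  have "0 < r k * (r (k - 1) choose t)"
    using r[OF k(1)] r[OF k(2)] by simp
  then have "1 \<le> c" unfolding c_def by linarith
  show ?thesis
  proof (rule extrastrong_cross_star_of_bounds[where T = ?T and r = r
        and f = "\<lambda>i. (n i - t - 1) choose (r i - t - 1)"
        and f' = "\<lambda>i. (n i - (t + 1) - 1) choose (r i - (t + 1) - 1)", OF assms(1) _ _ T])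
    fix i assume i: "i \<in> {1..k}"
    show "finite (composition_family (n i) (r i))"
      by (simp add: composition_family_def finite_compositions)
    show "card (subfamily_containing (composition_family (n i) (r i)) ?T)
        = (n i - t - 1) choose (r i - t - 1)"
      using card_star_le[OF T, of "r i" "n i"] card_initial_ones_star_ge[of t "r i" "n i"]
        r[OF i] rn[OF i] by (intro antisym) auto
    show "((n i - (t + 1) - 1) choose (r i - (t + 1) - 1)) < (n i - t - 1) choose (r i - t - 1)"
      using less[OF i] mult_le_mono1[OF \<open>1 \<le> c\<close>] by (metis le_less_trans mult_1)
  next
    fix i A assume "i \<in> {1..k}" "A \<in> composition_family (n i) (r i)"
    then show "finite A \<and> card A = r i"
      using composition_set_finite_card by (auto simp: composition_family_def compositions_def)
  next
    fix i and S :: "(nat \<times> nat) set" assume "i \<in> {1..k}" "finite S" "card S = t"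
    then show "card (subfamily_containing (composition_family (n i) (r i)) S)
        \<le> (n i - t - 1) choose (r i - t - 1)"
      using card_star_le[of S t "r i" "n i"] r[of i] by simp
  next
    fix i and S :: "(nat \<times> nat) set" assume "i \<in> {1..k}" "finite S" "card S = Suc t"
    then show "card (subfamily_containing (composition_family (n i) (r i)) S)
        \<le> (n i - (t + 1) - 1) choose (r i - (t + 1) - 1)"
      using card_star_le[of S "t + 1" "r i" "n i"] r[of i] by simp
  next
    fix i j assume ij: "i \<in> {1..k}" "j \<in> {1..k}" "i \<noteq> j"
    show "r j * (r i choose t) * ((n i - (t + 1) - 1) choose (r i - (t + 1) - 1))
        < (n i - t - 1) choose (r i - t - 1)"
      using mult_le_mono1[OF c_ge[OF ij]] less[OF ij(1)] by (rule le_less_trans)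
  qed
qed

end
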